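(* Let $1\le p\le\infty$. In what follows all the spaces $X_n$ are real infinite-dimensional Banach spaces. (1) For every $N\ge 1$ and all $X_1,\dots,X_N$, $$T(X_1 \oplus_p \cdots \oplus_p X_N) \le \max \{T(X_n) : 1\le n\le N \}.$$ (2) If $1\le p<\infty$, then for every infinite sequence $(X_n)_{n\in\mathbb{N}}$, $$2^{1/p}\le T(\ell_p(X_n)) \le \Big( \big(\inf_{n} T(X_n)\big)^p+1\Big)^{1/p}.$$ The upper estimate is also valid for finite sums, i.e. for every $N\ge 1$ and all $X_1,\dots,X_N$, $T(X_1 \oplus_p \cdots \oplus_p X_N) \le \big( (\min_{1\le n\le N} T(X_n))^p+1\big)^{1/p}$. (3) For every infinite sequence $(X_n)_{n\in\mathbb{N}}$, $$T(\ell_\infty(X_n)) = \inf_{n} T(X_n).$$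
   Context: For a real Banach space $X$, let $B_X$ and $S_X$ denote its closed unit ball and its unit sphere, and let $B(x,r)$ denote the closed ball with center $x$ and radius $r$. The (Whitley) thickness constant of $X$ is $$T(X)= \inf\Big\{\varepsilon>0 : \exists\, n\in\mathbb{N},\ \exists\, \{x_1,\dots,x_n\} \subset S_X \text{ such that } B_X\subset\bigcup_{i=1}^{n}B(x_i,\varepsilon) \Big\}.$$ For $1\le p\le \infty$, $X_1\oplus_p\cdots\oplus_p X_N$ is the product space $X_1\times\cdots\times X_N$ with norm $\|(x_1,\dots,x_N)\|=\big\|(\|x_1\|,\dots,\|x_N\|)\big\|_p$, where $\|\cdot\|_p$ is the $\ell_p$-norm on $\mathbb{R}^N$. For an infinite sequence of Banach spaces $(X_n)_{n\in\mathbb{N}}$, $\ell_p(X_n)$ is the Banach space of all sequences $(x_n)_n$ with $x_n\in X_n$ and $(\|x_n\|)_n\in\ell_p$, with norm $\|(x_n)_n\|=\big\|(\|x_n\|)_n\big\|_p$ (for $p=\infty$: bounded sequences with the supremum norm). *)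

theory Defs
  imports "HOL-Analysis.Analysis" "HOL-Library.Function_Algebras"
begin

instantiation "fun" :: (type, real_vector) real_vector
begin

definition scaleR_fun :: "real \<Rightarrow> ('a \<Rightarrow> 'b) \<Rightarrow> 'a \<Rightarrow> 'b" where
  "scaleR_fun c f = (\<lambda>x. c *\<^sub>R f x)"

instance
  by standard (simp_all add: scaleR_fun_def fun_eq_iff scaleR_add_right scaleR_add_left)

end

(* A normed space is a linear subspace of an arbitrary real vector space 'a, with its own norm;
   the values of the norm off the subspace play no role.  In this way the members of a family of
   different spaces can share one type.  Nothing is lost: any family (X n) can be realised
   linearly and isometrically inside one vector space, for instance the direct sum of the X n. *)
record 'a nspace =
  vecs :: "'a set"
  vnorm :: "'a \<Rightarrow> real"

definition normed_space :: "'a::real_vector nspace \<Rightarrow> bool" where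
  "normed_space X \<longleftrightarrow>
     subspace (vecs X) \<and>
     (\<forall>x\<in>vecs X. 0 \<le> vnorm X x \<and> (vnorm X x = 0 \<longleftrightarrow> x = 0)) \<and>
     (\<forall>c. \<forall>x\<in>vecs X. vnorm X (c *\<^sub>R x) = \<bar>c\<bar> * vnorm X x) \<and>
     (\<forall>x\<in>vecs X. \<forall>y\<in>vecs X. vnorm X (x + y) \<le> vnorm X x + vnorm X y)"

definition banach_space :: "'a::real_vector nspace \<Rightarrow> bool" where
  "banach_space X \<longleftrightarrow>
     normed_space X \<and>
     (\<forall>s::nat \<Rightarrow> 'a.
        (\<forall>n. s n \<in> vecs X) \<longrightarrow>
        (\<forall>e>0. \<exists>M. \<forall>m\<ge>M. \<forall>n\<ge>M. vnorm X (s m - s n) < e) \<longrightarrow>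
        (\<exists>l\<in>vecs X. (\<lambda>n. vnorm X (s n - l)) \<longlonglongrightarrow> 0))"

definition infinite_dimensional :: "'a::real_vector nspace \<Rightarrow> bool" where
  "infinite_dimensional X \<longleftrightarrow> \<not> (\<exists>B. finite B \<and> span B = vecs X)"

definition closed_ball :: "'a::real_vector nspace \<Rightarrow> 'a \<Rightarrow> real \<Rightarrow> 'a set" where
  "closed_ball X x r = {y \<in> vecs X. vnorm X (y - x) \<le> r}"

definition unit_ball :: "'a::real_vector nspace \<Rightarrow> 'a set" where
  "unit_ball X = {x \<in> vecs X. vnorm X x \<le> 1}"

definition unit_sphere :: "'a::real_vector nspace \<Rightarrow> 'a set" where
  "unit_sphere X = {x \<in> vecs X. vnorm X x = 1}"

definition thickness :: "'a::real_vector nspace \<Rightarrow> real" where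
  "thickness X =
     Inf {\<epsilon>. \<epsilon> > 0 \<and>
       (\<exists>F. finite F \<and> F \<subseteq> unit_sphere X \<and> unit_ball X \<subseteq> (\<Union>x\<in>F. closed_ball X x \<epsilon>))}"

(* For a finite index set I, ell p I is the set of all real families on I. *)
definition ell :: "ereal \<Rightarrow> 'i set \<Rightarrow> ('i \<Rightarrow> real) set" where
  "ell p I = {a. if p = \<infinity> then bdd_above ((\<lambda>i. \<bar>a i\<bar>) ` I)
                 else (\<lambda>i. \<bar>a i\<bar> powr real_of_ereal p) summable_on I}"

definition ell_norm :: "ereal \<Rightarrow> 'i set \<Rightarrow> ('i \<Rightarrow> real) \<Rightarrow> real" where
  "ell_norm p I a =
     (if p = \<infinity> then (SUP i\<in>I. \<bar>a i\<bar>)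
      else (\<Sum>\<^sub>\<infinity>i\<in>I. \<bar>a i\<bar> powr real_of_ereal p) powr (1 / real_of_ereal p))"

(* The p-sum of the spaces X i, i in I: the finite sum X 1 + ... + X N for I = {1..N}, the sequence
   space for I = UNIV.  A family on I is encoded as a function vanishing off I. *)
definition ell_sum :: "ereal \<Rightarrow> 'i set \<Rightarrow> ('i \<Rightarrow> 'a::real_vector nspace) \<Rightarrow> ('i \<Rightarrow> 'a) nspace" where
  "ell_sum p I X =
     \<lparr>vecs = {x. (\<forall>i\<in>I. x i \<in> vecs (X i)) \<and> (\<forall>i. i \<notin> I \<longrightarrow> x i = 0) \<and>
                 (\<lambda>i. vnorm (X i) (x i)) \<in> ell p I},
      vnorm = (\<lambda>x. ell_norm p I (\<lambda>i. vnorm (X i) (x i)))\<rparr>"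

end

(* The upper estimate for finite sums comes from a finite family of positive weights b with
   ||b||_p = 1 such that every vector of norms a with ||a||_p <= 1 satisfies a <= (1 + d) b for
   some b in the family: if f_i runs over an e-net of the ball of X_i, the points (b_i f_i) form an
   (e + d)-net.  The estimates by the infimum use centres supported on one good coordinate; for
   p = infinity this needs that the thickness of an infinite-dimensional space is at least 1, by
   Riesz' lemma.  For the bound 2^(1/p), finitely many centres almost vanish at some coordinate n,
   so a unit vector of X_n is at distance almost 2^(1/p) from each of them.  For the lower bound
   with p = infinity, each centre almost attains its norm at some coordinate; in every coordinate
   one avoids the normalised entries of the finitely many centres assigned to it. *)
theory Submission
  imports Defs
begin

section \<open>Finite covers and thickness\<close>

text \<open>The admissible radii get a name so that every estimate can be proved at a fixed radius;
  the infimum enters only through \<open>thickness_le\<close>, \<open>le_thickness\<close> and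
  \<open>coverable_if_less\<close>.\<close>

definition coverable :: "'a::real_vector nspace \<Rightarrow> real \<Rightarrow> bool" where
  "coverable X e \<longleftrightarrow> e > 0 \<and>
     (\<exists>F. finite F \<and> F \<subseteq> unit_sphere X \<and> unit_ball X \<subseteq> (\<Union>x\<in>F. closed_ball X x e))"

lemma thickness_coverable: "thickness X = Inf {e. coverable X e}"
  by (simp add: thickness_def coverable_def)

lemma coverable_pos: "coverable X e \<Longrightarrow> 0 < e"
  by (simp add: coverable_def)

lemma coverableE:
  assumes "coverable X e"
  obtains F where "finite F" "F \<subseteq> unit_sphere X"
    "\<And>y. \<lbrakk>y \<in> vecs X; vnorm X y \<le> 1\<rbrakk> \<Longrightarrow> \<exists>x\<in>F. vnorm X (y - x) \<le> e"
proof -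
  obtain F where F: "finite F" "F \<subseteq> unit_sphere X" "unit_ball X \<subseteq> (\<Union>x\<in>F. closed_ball X x e)"
    using assms by (auto simp: coverable_def)
  have "\<exists>x\<in>F. vnorm X (y - x) \<le> e" if "y \<in> vecs X" "vnorm X y \<le> 1" for y
    using F(3) that by (auto simp: unit_ball_def closed_ball_def)
  with F show thesis using that by blast
qed

lemma coverableI:
  assumes "0 < e" "finite F" "F \<subseteq> unit_sphere X"
    and "\<And>y. \<lbrakk>y \<in> vecs X; vnorm X y \<le> 1\<rbrakk> \<Longrightarrow> \<exists>x\<in>F. vnorm X (y - x) \<le> e"
  shows "coverable X e"
proof -
  have "unit_ball X \<subseteq> (\<Union>x\<in>F. closed_ball X x e)"
    using assms(4) by (auto simp: unit_ball_def closed_ball_def)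
  with assms show ?thesis by (auto simp: coverable_def)
qed

lemma coverable_mono:
  assumes "coverable X e" "e \<le> e'"
  shows "coverable X e'"
proof -
  obtain F where F: "finite F" "F \<subseteq> unit_sphere X"
    "\<And>y. \<lbrakk>y \<in> vecs X; vnorm X y \<le> 1\<rbrakk> \<Longrightarrow> \<exists>x\<in>F. vnorm X (y - x) \<le> e"
    using assms(1) by (rule coverableE) blast
  have "\<exists>x\<in>F. vnorm X (y - x) \<le> e'" if "y \<in> vecs X" "vnorm X y \<le> 1" for y
    using F(3)[OF that] assms(2) by force
  with F coverable_pos[OF assms(1)] assms(2) show ?thesis
    by (intro coverableI[of _ F]) auto
qed

lemma thickness_le: "coverable X e \<Longrightarrow> thickness X \<le> e"
  unfolding thickness_coverable
  by (rule cInf_lower) (auto intro!: bdd_belowI[of _ 0] dest: coverable_pos)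

text \<open>The witness \<open>e0\<close> makes the set of radii nonempty; the infimum of the empty
  set of reals carries no information.\<close>

lemma le_thickness:
  assumes "coverable X e0" "\<And>e. coverable X e \<Longrightarrow> c \<le> e"
  shows "c \<le> thickness X"
  unfolding thickness_coverable using assms by (intro cInf_greatest) auto

lemma coverable_if_less:
  assumes "coverable X e0" "thickness X < e"
  shows "coverable X e"
proof -
  have "\<exists>e'\<in>{e. coverable X e}. e' < e"
    using assms unfolding thickness_coverable by (intro cInf_lessD) auto
  then show ?thesis by (auto intro: coverable_mono less_imp_le)
qed

section \<open>Norms on subspaces and Riesz' lemma\<close>

context
  fixes X :: "'a::real_vector nspace"
  assumes X: "normed_space X"
begin

lemma ns_subspace: "subspace (vecs X)"
  and ns_nonneg: "x \<in> vecs X \<Longrightarrow> 0 \<le> vnorm X x"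
  and ns_eq_0: "x \<in> vecs X \<Longrightarrow> vnorm X x = 0 \<longleftrightarrow> x = 0"
  and ns_scale: "x \<in> vecs X \<Longrightarrow> vnorm X (c *\<^sub>R x) = \<bar>c\<bar> * vnorm X x"
  and ns_triangle: "\<lbrakk>x \<in> vecs X; y \<in> vecs X\<rbrakk> \<Longrightarrow> vnorm X (x + y) \<le> vnorm X x + vnorm X y"
  using X by (auto simp: normed_space_def)

lemma ns_mem: "0 \<in> vecs X" "x \<in> vecs X \<Longrightarrow> c *\<^sub>R x \<in> vecs X"
  "\<lbrakk>x \<in> vecs X; y \<in> vecs X\<rbrakk> \<Longrightarrow> x + y \<in> vecs X"
  "\<lbrakk>x \<in> vecs X; y \<in> vecs X\<rbrakk> \<Longrightarrow> x - y \<in> vecs X"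
  using ns_subspace by (auto simp: subspace_0 subspace_scale subspace_add subspace_diff)

lemma ns_zero: "vnorm X 0 = 0"
  using ns_eq_0 ns_mem(1) by blast

lemma ns_minus: "x \<in> vecs X \<Longrightarrow> vnorm X (- x) = vnorm X x"
  using ns_scale[of x "-1"] by simp

lemma ns_minus_commute: "\<lbrakk>x \<in> vecs X; y \<in> vecs X\<rbrakk> \<Longrightarrow> vnorm X (x - y) = vnorm X (y - x)"
  using ns_minus[of "x - y"] ns_mem by simp

lemma ns_triangle3:
  assumes "x \<in> vecs X" "y \<in> vecs X" "z \<in> vecs X"
  shows "vnorm X (x - z) \<le> vnorm X (x - y) + vnorm X (y - z)"
  using ns_triangle[of "x - y" "y - z"] assms ns_mem by simp

lemma ns_triangle_sub:
  assumes "x \<in> vecs X" "y \<in> vecs X"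
  shows "vnorm X x - vnorm X y \<le> vnorm X (x - y)"
  using ns_triangle[of "x - y" y] assms ns_mem by simp

lemma ns_triangle_diff:
  assumes "x \<in> vecs X" "y \<in> vecs X"
  shows "vnorm X (x - y) \<le> vnorm X x + vnorm X y"
  using ns_triangle[of x "- y"] assms ns_mem(2)[of y "-1"] ns_minus by simp

lemma ns_normalize:
  assumes "x \<in> vecs X" "vnorm X x \<noteq> 0"
  shows "(1 / vnorm X x) *\<^sub>R x \<in> unit_sphere X"
  using assms ns_mem(2) ns_nonneg by (simp add: unit_sphere_def ns_scale)

lemma infinite_dimensional_unit_vector:
  assumes "infinite_dimensional X"
  obtains u where "u \<in> unit_sphere X"
proof -
  have "span {} \<noteq> vecs X" using assms by (auto simp: infinite_dimensional_def)
  then obtain x where "x \<in> vecs X" "x \<noteq> 0" using ns_mem(1) by auto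
  with ns_normalize ns_eq_0 that show thesis by blast
qed

text \<open>By the triangle inequality a single unit vector serves as centre. This supplies an
  admissible radius whenever the infimum defining the thickness is evaluated.\<close>

lemma coverable_2:
  assumes "infinite_dimensional X"
  shows "coverable X 2"
proof -
  obtain u where u: "u \<in> vecs X" "vnorm X u = 1"
    using infinite_dimensional_unit_vector[OF assms] by (auto simp: unit_sphere_def)
  show ?thesis
  proof (rule coverableI[of _ "{u}"])
    show "\<exists>x\<in>{u}. vnorm X (y - x) \<le> 2" if "y \<in> vecs X" "vnorm X y \<le> 1" for y
      using ns_triangle_diff[OF that(1) u(1)] u that by simp
  qed (use u in \<open>auto simp: unit_sphere_def\<close>)
qed

text \<open>Completeness of finite-dimensional subspaces is avoided: if the points
  \<open>y k = w k + t k b\<close> with \<open>w k\<close> in the span of \<open>B\<close> approach \<open>z\<close>, the positive distance of \<open>b\<close>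
  to that span makes \<open>t\<close> a Cauchy sequence with a limit \<open>c\<close>, and then \<open>z - c b\<close> has
  distance zero to the span of \<open>B\<close>.\<close>

lemma finite_span_distance_pos:
  assumes "finite B" "B \<subseteq> vecs X" "z \<in> vecs X" "z \<notin> span B"
  obtains d where "d > 0" "\<And>y. y \<in> span B \<Longrightarrow> d \<le> vnorm X (z - y)"
proof -
  have "\<exists>d>0. \<forall>y\<in>span B. d \<le> vnorm X (z - y)"
    using assms
  proof (induction B arbitrary: z rule: finite_induct)
    case empty
    then have "vnorm X z > 0" using ns_nonneg[of z] ns_eq_0[of z] by fastforce
    then show ?case by (intro exI[of _ "vnorm X z"]) auto
  next
    case (insert b B)
    have sub: "span B \<subseteq> vecs X" "span (insert b B) \<subseteq> vecs X"
      using insert.prems ns_subspace by (intro span_minimal; auto)+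
    have zB: "z \<notin> span B" using insert.prems(3) span_mono[of B "insert b B"] by blast
    show ?case
    proof (cases "b \<in> span B")
      case True
      then show ?thesis using insert.IH[of z] insert.prems zB by (simp add: span_redundant)
    next
      case False
      obtain d0 where d0: "d0 > 0" "\<And>y. y \<in> span B \<Longrightarrow> d0 \<le> vnorm X (b - y)"
        using insert.IH[of b] insert.prems False by blast
      have scaled: "\<bar>s\<bar> * d0 \<le> vnorm X (s *\<^sub>R b + w)" if "w \<in> span B" for s w
      proof (cases "s = 0")
        case True
        then show ?thesis using that sub ns_nonneg by auto
      next
        \<comment> \<open>Factoring out \<open>s\<close> leaves \<open>b\<close> minus an element of
          \<open>span B\<close>, so the bound \<open>d0\<close> applies.\<close>
        case s: False
        have "s *\<^sub>R b + w = s *\<^sub>R (b - (- (1 / s)) *\<^sub>R w)" using s by (simp add: algebra_simps)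
        moreover have "b - (- (1 / s)) *\<^sub>R w \<in> vecs X"
          using that sub insert.prems by (intro ns_mem) auto
        moreover have "d0 \<le> vnorm X (b - (- (1 / s)) *\<^sub>R w)"
          using that by (intro d0) (auto simp: span_scale span_neg)
        ultimately show ?thesis by (simp only: ns_scale) (simp add: mult_left_mono)
      qed
      show ?thesis
      proof (rule ccontr)
        assume neg: "\<not> ?thesis"
        have "\<exists>y\<in>span (insert b B). vnorm X (z - y) < inverse (real (Suc k))" for k
          using neg by (auto simp: not_le dest!: spec[of _ "inverse (real (Suc k))"])
        then obtain y where y: "\<And>k. y k \<in> span (insert b B)"
          "\<And>k. vnorm X (z - y k) < inverse (real (Suc k))" by metis
        have "\<exists>t. y k - t *\<^sub>R b \<in> span B" for k
          using span_breakdown_eq y(1) by blast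
        then obtain t where t: "\<And>k. y k - t k *\<^sub>R b \<in> span B" by metis
        have yX: "y k \<in> vecs X" for k using y(1) sub by blast
        have yz: "(\<lambda>k. vnorm X (z - y k)) \<longlonglongrightarrow> 0"
          by (rule tendsto_sandwich[OF _ _ tendsto_const LIMSEQ_inverse_real_of_nat])
             (use y(2) ns_nonneg ns_mem insert.prems yX in \<open>auto intro!: always_eventually less_imp_le\<close>)
        have tkl: "\<bar>t k - t l\<bar> * d0 \<le> vnorm X (z - y k) + vnorm X (z - y l)" for k l
        proof -
          have "(y k - t k *\<^sub>R b) - (y l - t l *\<^sub>R b) \<in> span B" using t[of k] t[of l] by (rule span_diff)
          from scaled[OF this, of "t k - t l"]
          have "\<bar>t k - t l\<bar> * d0 \<le> vnorm X (y k - y l)" by (simp add: algebra_simps)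
          also have "\<dots> \<le> vnorm X (y k - z) + vnorm X (z - y l)"
            using yX insert.prems by (intro ns_triangle3) auto
          finally show ?thesis using ns_minus_commute yX insert.prems by simp
        qed
        have "Cauchy t"
        proof (rule CauchyI')
          fix e :: real assume "0 < e"
          then have "\<forall>\<^sub>F k in sequentially. vnorm X (z - y k) < e * d0 / 2"
            using d0 by (intro order_tendstoD(2)[OF yz]) simp
          then obtain M where M: "\<And>k. k \<ge> M \<Longrightarrow> vnorm X (z - y k) < e * d0 / 2"
            by (auto simp: eventually_sequentially)
          have "dist (t k) (t l) < e" if "k \<ge> M" "l > k" for k l
          proof -
            have "\<bar>t k - t l\<bar> * d0 < e * d0" using tkl[of k l] M[of k] M[of l] that by simp
            then show ?thesis using d0 by (simp add: dist_real_def)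
          qed
          then show "\<exists>M. \<forall>m\<ge>M. \<forall>n>m. dist (t m) (t n) < e" by blast
        qed
        then obtain c where c: "t \<longlonglongrightarrow> c" using Cauchy_convergent_iff convergent_def by blast
        have "z - c *\<^sub>R b \<notin> span B" using insert.prems(3) span_breakdown_eq by blast
        moreover have "z - c *\<^sub>R b \<in> vecs X" using insert.prems ns_mem(2,4) by simp
        ultimately obtain d1 where d1: "d1 > 0"
          "\<And>y. y \<in> span B \<Longrightarrow> d1 \<le> vnorm X (z - c *\<^sub>R b - y)"
          using insert.IH[of "z - c *\<^sub>R b"] insert.prems by auto
        \<comment> \<open>The point of \<open>span B\<close> compared with
          \<open>z - c *\<^sub>R b\<close> is the \<open>B\<close>-part of \<open>y k\<close>. The
          error splits into the approximation error of \<open>y k\<close> and the deviation of the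
          coefficient \<open>t k\<close> from its limit, and both tend to 0.\<close>
        have bound: "d1 \<le> vnorm X (z - y k) + \<bar>t k - c\<bar> * vnorm X b" for k
        proof -
          have "d1 \<le> vnorm X (z - c *\<^sub>R b - (y k - t k *\<^sub>R b))" using d1 t by blast
          also have "z - c *\<^sub>R b - (y k - t k *\<^sub>R b) = (z - y k) + (t k - c) *\<^sub>R b"
            by (simp only: scaleR_left_diff_distrib) simp
          also have "vnorm X \<dots> \<le> vnorm X (z - y k) + vnorm X ((t k - c) *\<^sub>R b)"
            using insert.prems yX ns_mem(2,4) by (intro ns_triangle) simp_all
          finally show ?thesis using ns_scale[of b "t k - c"] insert.prems(1) by simp
        qed
        have lim: "(\<lambda>k. vnorm X (z - y k) + \<bar>t k - c\<bar> * vnorm X b) \<longlonglongrightarrow> 0 + \<bar>c - c\<bar> * vnorm X b"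
          by (intro tendsto_intros yz c)
        have "d1 \<le> 0 + \<bar>c - c\<bar> * vnorm X b"
          using LIMSEQ_le_const[OF lim] bound by blast
        then show False using d1 by simp
      qed
    qed
  qed
  with that show thesis by blast
qed

text \<open>This is Riesz' argument. Take \<open>z\<close> outside the span of the centres and
  \<open>y\<close> in the span nearly closest to \<open>z\<close>. If a centre \<open>f\<close> were
  within \<open>e < 1\<close> of the normalised \<open>z - y\<close>, then the point
  \<open>y + r *\<^sub>R f\<close> of the span would be closer to \<open>z\<close> than the distance
  from \<open>z\<close> to the span.\<close>

lemma coverable_ge_1:
  assumes "infinite_dimensional X" "coverable X e"
  shows "1 \<le> e"
proof (rule ccontr)
  assume "\<not> 1 \<le> e"
  with coverable_pos[OF assms(2)] have e: "0 < e" "e < 1" by auto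
  obtain F where F: "finite F" "F \<subseteq> unit_sphere X"
    "\<And>y. \<lbrakk>y \<in> vecs X; vnorm X y \<le> 1\<rbrakk> \<Longrightarrow> \<exists>x\<in>F. vnorm X (y - x) \<le> e"
    using assms(2) by (rule coverableE) blast
  have FX: "F \<subseteq> vecs X" using F(2) by (auto simp: unit_sphere_def)
  then have spX: "span F \<subseteq> vecs X" using ns_subspace by (rule span_minimal)
  moreover have "span F \<noteq> vecs X" using assms(1) F(1) by (auto simp: infinite_dimensional_def)
  ultimately obtain z where z: "z \<in> vecs X" "z \<notin> span F" by blast
  obtain d where d: "d > 0" "\<And>y. y \<in> span F \<Longrightarrow> d \<le> vnorm X (z - y)"
    using finite_span_distance_pos[OF F(1) FX z] by blast
  \<comment> \<open>\<open>D\<close> is the distance from \<open>z\<close> to the span; it is at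
    least \<open>d > 0\<close>, and this makes \<open>D / e\<close> a strictly larger
    threshold.\<close>
  define D where "D = (INF y\<in>span F. vnorm X (z - y))"
  have bdd: "bdd_below ((\<lambda>y. vnorm X (z - y)) ` span F)" using d by (auto intro!: bdd_belowI[of _ d])
  have ne: "span F \<noteq> {}" using span_zero by blast
  have "d \<le> D" unfolding D_def using d ne by (intro cINF_greatest) auto
  then have "D < D / e" using e d by (simp add: field_simps)
  then obtain y where y: "y \<in> span F" "vnorm X (z - y) < D / e"
    using cINF_less_iff[OF ne bdd] unfolding D_def by blast
  define r where "r = vnorm X (z - y)"
  have r: "r > 0" using d y unfolding r_def by force
  have zy: "z - y \<in> vecs X" using z y spX ns_mem by blast
  have "(1 / r) *\<^sub>R (z - y) \<in> unit_sphere X" using ns_normalize[OF zy] r by (simp add: r_def)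
  then obtain f where f: "f \<in> F" "vnorm X ((1 / r) *\<^sub>R (z - y) - f) \<le> e"
    using F(3) by (force simp: unit_sphere_def)
  have "D \<le> vnorm X (z - (y + r *\<^sub>R f))"
    unfolding D_def using f y bdd by (intro cINF_lower) (auto intro!: span_add span_scale intro: span_base)
  also have "z - (y + r *\<^sub>R f) = r *\<^sub>R ((1 / r) *\<^sub>R (z - y) - f)"
    using r by (simp add: algebra_simps)
  also have "vnorm X \<dots> = r * vnorm X ((1 / r) *\<^sub>R (z - y) - f)"
    using r f FX zy ns_mem by (subst ns_scale) auto
  also have "\<dots> \<le> r * e" using r f by simp
  also have "\<dots> < D" using y e by (simp add: r_def field_simps)
  finally show False by simp
qed

end


lemma one_le_thickness:
  assumes "normed_space X" "infinite_dimensional X"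
  shows "1 \<le> thickness X"
  using le_thickness[OF coverable_2] coverable_ge_1 assms by blast

lemma coverable_if_thickness_less:
  assumes "normed_space X" "infinite_dimensional X" "thickness X < e"
  shows "coverable X e"
  using coverable_if_less[OF coverable_2] assms by blast

section \<open>Norms of families\<close>

lemma powr_inverse_le_iff:
  fixes s e q :: real
  assumes "0 \<le> s" "0 \<le> e" "0 < q"
  shows "s powr (1 / q) \<le> e \<longleftrightarrow> s \<le> e powr q"
proof
  assume "s powr (1 / q) \<le> e"
  then have "(s powr (1 / q)) powr q \<le> e powr q" using assms by (intro powr_mono2) auto
  then show "s \<le> e powr q" using assms by (simp add: powr_powr)
next
  assume "s \<le> e powr q"
  then have "s powr (1 / q) \<le> (e powr q) powr (1 / q)" using assms by (intro powr_mono2) auto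
  then show "s powr (1 / q) \<le> e" using assms by (simp add: powr_powr)
qed

lemma one_le_real_of_ereal:
  assumes "1 \<le> p" "p \<noteq> \<infinity>"
  shows "1 \<le> real_of_ereal p"
  using assms by (cases p) auto

lemma ell_norm_finite_exponent:
  "p \<noteq> \<infinity> \<Longrightarrow> ell_norm p I a =
     (\<Sum>\<^sub>\<infinity>i\<in>I. \<bar>a i\<bar> powr real_of_ereal p) powr (1 / real_of_ereal p)"
  by (simp add: ell_norm_def)

lemma ell_norm_infinity: "ell_norm \<infinity> I a = (SUP i\<in>I. \<bar>a i\<bar>)"
  by (simp add: ell_norm_def)

lemma ell_norm_cong:
  assumes "\<And>i. i \<in> I \<Longrightarrow> a i = b i"
  shows "ell_norm p I a = ell_norm p I b"
proof -
  have "(\<Sum>\<^sub>\<infinity>i\<in>I. \<bar>a i\<bar> powr real_of_ereal p) = (\<Sum>\<^sub>\<infinity>i\<in>I. \<bar>b i\<bar> powr real_of_ereal p)"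
    using assms by (intro infsum_cong) simp
  moreover have "(SUP i\<in>I. \<bar>a i\<bar>) = (SUP i\<in>I. \<bar>b i\<bar>)"
    using assms by (intro SUP_cong) auto
  ultimately show ?thesis by (simp add: ell_norm_def)
qed

lemma ell_finite: "finite I \<Longrightarrow> a \<in> ell p I"
  by (simp add: ell_def)

lemma ell_norm_le_iff:
  assumes "1 \<le> p" "p \<noteq> \<infinity>" "0 \<le> e"
  shows "ell_norm p I a \<le> e \<longleftrightarrow>
    (\<Sum>\<^sub>\<infinity>i\<in>I. \<bar>a i\<bar> powr real_of_ereal p) \<le> e powr real_of_ereal p"
  using one_le_real_of_ereal[OF assms(1,2)] assms
  by (simp add: ell_norm_finite_exponent powr_inverse_le_iff infsum_nonneg)

lemma ell_norm_eq_1_iff: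
  assumes "1 \<le> p" "p \<noteq> \<infinity>"
  shows "ell_norm p I a = 1 \<longleftrightarrow> (\<Sum>\<^sub>\<infinity>i\<in>I. \<bar>a i\<bar> powr real_of_ereal p) = 1"
proof -
  have q: "1 \<le> real_of_ereal p" using one_le_real_of_ereal[OF assms] .
  define s where "s = (\<Sum>\<^sub>\<infinity>i\<in>I. \<bar>a i\<bar> powr real_of_ereal p)"
  have "0 \<le> s" unfolding s_def by (intro infsum_nonneg) auto
  have "s = 1" if "s powr (1 / real_of_ereal p) = 1"
  proof -
    have "s = (s powr (1 / real_of_ereal p)) powr real_of_ereal p"
      using q \<open>0 \<le> s\<close> by (simp add: powr_powr)
    also have "\<dots> = 1" unfolding that by simp
    finally show ?thesis .
  qed
  then show ?thesis using assms by (auto simp: ell_norm_finite_exponent s_def)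
qed

text \<open>This combines monotonicity and homogeneity of the norm, and turns weighted error
  estimates in the coordinates into one error estimate in the sum.\<close>

lemma ell_norm_le_dominated:
  assumes "1 \<le> p" "finite I" "I \<noteq> {}" "0 \<le> r"
    and d: "\<And>i. i \<in> I \<Longrightarrow> \<bar>d i\<bar> \<le> r * b i"
    and b: "\<And>i. i \<in> I \<Longrightarrow> 0 < b i" "ell_norm p I b = 1"
  shows "ell_norm p I d \<le> r"
proof (cases "p = \<infinity>")
  case True
  have "\<bar>d i\<bar> \<le> r" if i: "i \<in> I" for i
  proof -
    have "\<bar>b i\<bar> \<le> (SUP i\<in>I. \<bar>b i\<bar>)" using assms(2) i by (intro cSUP_upper) auto
    then have "b i \<le> 1" using b True by (simp add: ell_norm_infinity)
    then have "r * b i \<le> r" using assms(4) by (simp add: mult_left_le)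
    with d[OF i] show ?thesis by simp
  qed
  then show ?thesis unfolding True ell_norm_infinity using assms by (intro cSUP_least) auto
next
  case False
  have q: "1 \<le> real_of_ereal p" using one_le_real_of_ereal[OF assms(1) False] .
  have sb: "(\<Sum>i\<in>I. \<bar>b i\<bar> powr real_of_ereal p) = 1"
    using b(2) assms False by (simp add: ell_norm_eq_1_iff)
  have "\<bar>d i\<bar> powr real_of_ereal p \<le> r powr real_of_ereal p * \<bar>b i\<bar> powr real_of_ereal p"
    if "i \<in> I" for i
  proof -
    have "\<bar>d i\<bar> powr real_of_ereal p \<le> (r * \<bar>b i\<bar>) powr real_of_ereal p"
      using d[OF that] b(1)[OF that] q by (intro powr_mono2) auto
    then show ?thesis using assms(4) by (simp add: powr_mult)
  qed
  then have "(\<Sum>i\<in>I. \<bar>d i\<bar> powr real_of_ereal p)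
      \<le> (\<Sum>i\<in>I. r powr real_of_ereal p * \<bar>b i\<bar> powr real_of_ereal p)"
    by (rule sum_mono)
  also have "\<dots> = r powr real_of_ereal p"
    using sb by (simp only: sum_distrib_left[symmetric] mult_1_right)
  finally show ?thesis using assms False by (simp add: ell_norm_le_iff)
qed

text \<open>The weights are \<open>b i = (k i / sum k)\<close> to the power \<open>1 / p\<close> with integers \<open>k i\<close> between 1
  and \<open>K + 1\<close>; given \<open>a\<close>, one takes \<open>k i\<close> just above \<open>K\<close> times the \<open>p\<close>-th power of \<open>a i\<close>.\<close>

lemma ell_norm_grid:
  assumes "1 \<le> p" "finite I" "I \<noteq> {}" "0 < \<delta>"
  shows "\<exists>W :: ('i \<Rightarrow> real) set. finite W \<and>
    (\<forall>b\<in>W. (\<forall>i\<in>I. 0 < b i) \<and> ell_norm p I b = 1) \<and>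
    (\<forall>a. (\<forall>i\<in>I. 0 \<le> a i) \<and> ell_norm p I a \<le> 1 \<longrightarrow> (\<exists>b\<in>W. \<forall>i\<in>I. a i \<le> (1 + \<delta>) * b i))"
proof (cases "p = \<infinity>")
  case True
  \<comment> \<open>In the supremum norm every entry of \<open>a\<close> is at most 1, so the
    constant weight 1 alone suffices.\<close>
  show ?thesis
  proof (intro exI[of _ "{\<lambda>_. 1}"] conjI allI impI)
    fix a :: "'i \<Rightarrow> real"
    assume a: "(\<forall>i\<in>I. 0 \<le> a i) \<and> ell_norm p I a \<le> 1"
    have "a i \<le> 1 + \<delta>" if "i \<in> I" for i
    proof -
      have "\<bar>a i\<bar> \<le> (SUP i\<in>I. \<bar>a i\<bar>)" using assms(2) that by (intro cSUP_upper) auto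
      also have "\<dots> \<le> 1" using a unfolding True ell_norm_infinity by (rule conjunct2)
      finally show ?thesis using assms(4) by linarith
    qed
    then show "\<exists>b\<in>{\<lambda>_. 1}. \<forall>i\<in>I. a i \<le> (1 + \<delta>) * b i" by simp
  qed (use assms True in \<open>auto simp: ell_norm_infinity\<close>)
next
  case False
  define q where "q = real_of_ereal p"
  have q: "1 \<le> q" using one_le_real_of_ereal[OF assms(1) False] by (simp add: q_def)
  define N where "N = card I"
  \<comment> \<open>Rounding raises each of the \<open>N\<close> entries by at most 1, hence the
    total by at most \<open>N\<close>; the choice of \<open>K\<close> makes this at most
    \<open>\<delta> * real K\<close>.\<close>
  obtain K :: nat where K: "real N / \<delta> < real K" using reals_Archimedean2 by blast
  have "0 \<le> real N / \<delta>" using assms(4) by simp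
  with K have K0: "K > 0" by linarith
  have NK: "real N \<le> \<delta> * real K"
    using K by (simp only: pos_divide_less_eq[OF assms(4)] mult.commute[of \<delta>] less_imp_le)
  define w where "w = (\<lambda>k :: 'i \<Rightarrow> nat. \<lambda>i. (real (k i) / (\<Sum>j\<in>I. real (k j))) powr (1 / q))"
  define P where "P = PiE I (\<lambda>_. {1..K + 1})"
  have pos: "0 < (\<Sum>j\<in>I. real (k j))" "\<And>i. i \<in> I \<Longrightarrow> 0 < k i" if "k \<in> P" for k
  proof -
    show k: "0 < k i" if "i \<in> I" for i
    proof -
      have "k i \<in> {1..K + 1}" using \<open>k \<in> P\<close> that unfolding P_def by (rule PiE_mem)
      then show ?thesis by simp
    qed
    then show "0 < (\<Sum>j\<in>I. real (k j))" using assms by (intro sum_pos) auto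
  qed
  show ?thesis
  proof (intro exI[of _ "w ` P"] conjI allI impI ballI)
    show "finite (w ` P)" unfolding P_def using assms by (intro finite_imageI finite_PiE) auto
    show "0 < b i" if b: "b \<in> w ` P" and i: "i \<in> I" for b i
    proof -
      obtain k where k: "k \<in> P" "b = w k" using b by blast
      have "0 < real (k i) / (\<Sum>j\<in>I. real (k j))"
        using pos(1)[OF k(1)] pos(2)[OF k(1) i] by (intro divide_pos_pos) simp_all
      then show ?thesis
        unfolding k(2) w_def powr_gt_zero by (rule less_imp_neq[symmetric])
    qed
    show "ell_norm p I b = 1" if b: "b \<in> w ` P" for b
    proof -
      obtain k where k: "k \<in> P" "b = w k" using b by blast
      have "\<bar>b i\<bar> powr q = real (k i) / (\<Sum>j\<in>I. real (k j))" if "i \<in> I" for i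
        using q pos(1)[OF k(1)] by (simp add: k w_def powr_powr)
      then have "(\<Sum>i\<in>I. \<bar>b i\<bar> powr q) = (\<Sum>j\<in>I. real (k j)) / (\<Sum>j\<in>I. real (k j))"
        by (simp flip: sum_divide_distrib)
      then show ?thesis using pos(1)[OF k(1)] assms False by (simp add: ell_norm_eq_1_iff q_def)
    qed
    fix a :: "'i \<Rightarrow> real"
    assume "(\<forall>i\<in>I. 0 \<le> a i) \<and> ell_norm p I a \<le> 1"
    then have a: "\<And>i. i \<in> I \<Longrightarrow> 0 \<le> a i" "ell_norm p I a \<le> 1" by blast+
    \<comment> \<open>Adding 1 to the floor keeps \<open>k i\<close> positive and at least
      \<open>real K * a i powr q\<close>, even where \<open>a i\<close> vanishes; the restricted
      abstraction puts \<open>k\<close> into \<open>PiE\<close>.\<close>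
    define k where "k = (\<lambda>i\<in>I. nat \<lfloor>real K * a i powr q\<rfloor> + 1)"
    have "(\<Sum>i\<in>I. \<bar>a i\<bar> powr q) \<le> 1"
      using a(2) assms False by (simp add: ell_norm_le_iff q_def)
    then have sa: "(\<Sum>i\<in>I. a i powr q) \<le> 1" using a(1) by simp
    have ai: "a i powr q \<le> 1" if "i \<in> I" for i
      using member_le_sum[of i I "\<lambda>i. a i powr q"] assms(2) that sa by simp
    have kb: "real (k i) \<le> real K * a i powr q + 1" "real K * a i powr q \<le> real (k i)"
      if "i \<in> I" for i
      using that by (simp_all add: k_def) linarith+
    have "k i \<le> K + 1" if "i \<in> I" for i
    proof -
      have "real (k i) \<le> real K + 1"
        using kb(1)[OF that] mult_left_le[OF ai[OF that] of_nat_0_le_iff[of K]] by linarith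
      then show ?thesis by simp
    qed
    then have kP: "k \<in> P" unfolding P_def by (intro PiE_I) (auto simp: k_def)
    have "(\<Sum>j\<in>I. real (k j)) \<le> (\<Sum>i\<in>I. real K * a i powr q + 1)"
      by (intro sum_mono kb)
    also have "\<dots> = real K * (\<Sum>i\<in>I. a i powr q) + real N"
      by (simp add: sum.distrib sum_distrib_left N_def)
    also have "\<dots> \<le> real K * 1 + \<delta> * real K" using sa NK by (intro add_mono mult_left_mono) auto
    finally have sk: "(\<Sum>j\<in>I. real (k j)) \<le> (1 + \<delta>) * real K" by (simp add: algebra_simps)
    have "a i \<le> (1 + \<delta>) * w k i" if i: "i \<in> I" for i
    proof -
      have s0: "0 < (\<Sum>j\<in>I. real (k j))" using pos(1)[OF kP] .
      have "a i powr q \<le> real (k i) / real K" using kb(2)[OF i] K0 by (simp add: field_simps)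
      also have "\<dots> \<le> (1 + \<delta>) * (real (k i) / (\<Sum>j\<in>I. real (k j)))"
      proof -
        have "real (k i) * (\<Sum>j\<in>I. real (k j)) \<le> real (k i) * ((1 + \<delta>) * real K)"
          using sk by (rule mult_left_mono) simp
        then show ?thesis using K0 s0 by (simp add: field_simps)
      qed
      finally have "(a i powr q) powr (1 / q) \<le> ((1 + \<delta>) * (real (k i) / (\<Sum>j\<in>I. real (k j)))) powr (1 / q)"
        using q by (intro powr_mono2) auto
      then have "a i \<le> (1 + \<delta>) powr (1 / q) * w k i"
        using a(1)[OF i] q by (simp only: powr_mult w_def) (simp add: powr_powr)
      \<comment> \<open>The exponent \<open>1 / q\<close> is at most 1 and the base exceeds 1, so
        the factor is bounded by \<open>1 + \<delta>\<close>.\<close>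
      also have "\<dots> \<le> (1 + \<delta>) powr 1 * w k i"
        using q assms(4) by (intro mult_right_mono powr_mono) (auto simp: w_def)
      finally show ?thesis using assms(4) by simp
    qed
    with kP show "\<exists>b\<in>w ` P. \<forall>i\<in>I. a i \<le> (1 + \<delta>) * b i" by blast
  qed
qed

section \<open>Sums of spaces\<close>

lemma vecs_ell_sum: "vecs (ell_sum p I X) =
    {x. (\<forall>i\<in>I. x i \<in> vecs (X i)) \<and> (\<forall>i. i \<notin> I \<longrightarrow> x i = 0) \<and> (\<lambda>i. vnorm (X i) (x i)) \<in> ell p I}"
  by (simp add: ell_sum_def)

lemma vnorm_ell_sum: "vnorm (ell_sum p I X) x = ell_norm p I (\<lambda>i. vnorm (X i) (x i))"
  by (simp add: ell_sum_def)

section \<open>The bound by the maximum for finite sums\<close>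

text \<open>Write \<open>y i\<close> as \<open>(1 + \<delta>) * b i\<close> times a point
  \<open>z i\<close> of the unit ball and take \<open>f i\<close> within \<open>e\<close> of
  \<open>z i\<close>. The error is \<open>b i\<close> times
  \<open>(z i - f i) + \<delta> *\<^sub>R z i\<close>, of norm at most
  \<open>(e + \<delta>) * b i\<close>; as \<open>b\<close> has norm 1, the total error is at most
  \<open>e + \<delta>\<close>.\<close>

lemma coverable_ell_sum_finite:
  fixes X :: "'i \<Rightarrow> 'a::real_vector nspace"
  assumes "1 \<le> p" "finite I" "I \<noteq> {}" "0 < \<delta>"
    and ns: "\<And>i. i \<in> I \<Longrightarrow> normed_space (X i)"
    and cov: "\<And>i. i \<in> I \<Longrightarrow> coverable (X i) e"
  shows "coverable (ell_sum p I X) (e + \<delta>)"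
proof -
  have e: "0 < e" using cov coverable_pos assms(3) by blast
  define is_net where "is_net = (\<lambda>i F. finite F \<and> F \<subseteq> unit_sphere (X i) \<and>
      (\<forall>y\<in>vecs (X i). vnorm (X i) y \<le> 1 \<longrightarrow> (\<exists>x\<in>F. vnorm (X i) (y - x) \<le> e)))"
  have "\<exists>F. is_net i F" if i: "i \<in> I" for i
    unfolding is_net_def by (rule coverableE[OF cov[OF i]]) blast
  then obtain F where net: "\<And>i. i \<in> I \<Longrightarrow> is_net i (F i)" by metis
  have F: "finite (F i)" "F i \<subseteq> unit_sphere (X i)"
    "\<And>y. \<lbrakk>y \<in> vecs (X i); vnorm (X i) y \<le> 1\<rbrakk> \<Longrightarrow> \<exists>x\<in>F i. vnorm (X i) (y - x) \<le> e"
    if "i \<in> I" for i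
    using net[OF that] unfolding is_net_def by simp_all
  obtain W :: "('i \<Rightarrow> real) set" where W: "finite W"
    "\<forall>b\<in>W. (\<forall>i\<in>I. 0 < b i) \<and> ell_norm p I b = 1"
    "\<forall>a. (\<forall>i\<in>I. 0 \<le> a i) \<and> ell_norm p I a \<le> 1 \<longrightarrow> (\<exists>b\<in>W. \<forall>i\<in>I. a i \<le> (1 + \<delta>) * b i)"
    using ell_norm_grid[OF assms(1-4)] by (elim exE conjE) (rule that)
  have Wpos: "0 < b i" if "b \<in> W" "i \<in> I" for b i
    using W(2) that by blast
  have Wnorm: "ell_norm p I b = 1" if "b \<in> W" for b
    using W(2) that by blast
  \<comment> \<open>The value 0 outside \<open>I\<close> is the one required by the encoding of
    families in \<open>ell_sum\<close>.\<close>
  define c where "c = (\<lambda>(b, f). \<lambda>i. if i \<in> I then b i *\<^sub>R (f i :: 'a) else 0)"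
  show ?thesis
  proof (rule coverableI[of _ "c ` (W \<times> PiE I F)"])
    show "0 < e + \<delta>" using e assms(4) by simp
    show "finite (c ` (W \<times> PiE I F))"
      using W(1) F(1) assms(2) by (intro finite_imageI finite_cartesian_product finite_PiE) auto
    show "c ` (W \<times> PiE I F) \<subseteq> unit_sphere (ell_sum p I X)"
    proof clarify
      fix b f assume b: "b \<in> W" and f: "f \<in> PiE I F"
      have fi: "f i \<in> vecs (X i)" "vnorm (X i) (f i) = 1" if "i \<in> I" for i
        using F(2)[OF that] PiE_mem[OF f that] by (auto simp: unit_sphere_def)
      have "vnorm (X i) (c (b, f) i) = b i" if "i \<in> I" for i
        using that Wpos[OF b that] fi[OF that] by (simp add: c_def ns_scale[OF ns[OF that]])
      then have "vnorm (ell_sum p I X) (c (b, f)) = 1"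
        unfolding vnorm_ell_sum using Wnorm[OF b] by (simp cong: ell_norm_cong)
      moreover have "c (b, f) i \<in> vecs (X i)" if "i \<in> I" for i
        using that fi[OF that] ns_mem(2)[OF ns[OF that]] by (simp add: c_def)
      ultimately show "c (b, f) \<in> unit_sphere (ell_sum p I X)"
        using ell_finite[OF assms(2)] by (simp add: unit_sphere_def vecs_ell_sum c_def)
    qed
    fix y assume y: "y \<in> vecs (ell_sum p I X)" "vnorm (ell_sum p I X) y \<le> 1"
    have yi: "y i \<in> vecs (X i)" "0 \<le> vnorm (X i) (y i)" if "i \<in> I" for i
      using y that ns_nonneg[OF ns[OF that]] by (auto simp: vecs_ell_sum)
    obtain b where b: "b \<in> W" "\<And>i. i \<in> I \<Longrightarrow> vnorm (X i) (y i) \<le> (1 + \<delta>) * b i"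
    proof -
      have "\<exists>b\<in>W. \<forall>i\<in>I. vnorm (X i) (y i) \<le> (1 + \<delta>) * b i"
        using y(2) yi(2) by (intro W(3)[rule_format]) (simp add: vnorm_ell_sum)
      then show thesis using that by blast
    qed
    define z where "z = (\<lambda>i. (1 / ((1 + \<delta>) * b i)) *\<^sub>R y i)"
    have z: "z i \<in> vecs (X i)" "vnorm (X i) (z i) \<le> 1" "y i = ((1 + \<delta>) * b i) *\<^sub>R z i"
      if "i \<in> I" for i
    proof -
      have pos: "0 < (1 + \<delta>) * b i" using Wpos[OF b(1) that] assms(4) by simp
      show "z i \<in> vecs (X i)" using yi[OF that] ns_mem(2)[OF ns[OF that]] by (simp add: z_def)
      show "vnorm (X i) (z i) \<le> 1" unfolding z_def
        using pos b(2)[OF that] yi[OF that] by (subst ns_scale[OF ns[OF that]]) (auto simp: field_simps)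
      show "y i = ((1 + \<delta>) * b i) *\<^sub>R z i"
        unfolding z_def using Wpos[OF b(1) that] assms(4) by simp
    qed
    have "\<forall>i\<in>I. \<exists>x\<in>F i. vnorm (X i) (z i - x) \<le> e" using F(3) z by blast
    then obtain f where f: "\<And>i. i \<in> I \<Longrightarrow> f i \<in> F i" "\<And>i. i \<in> I \<Longrightarrow> vnorm (X i) (z i - f i) \<le> e"
      by metis
    \<comment> \<open>Restricting \<open>f\<close> gives the default value \<open>undefined\<close>
      off \<open>I\<close> that \<open>PiE\<close> demands; \<open>c\<close> puts 0 there.\<close>
    define x where "x = c (b, restrict f I)"
    have "\<bar>vnorm (X i) (y i - x i)\<bar> \<le> (e + \<delta>) * b i" if i: "i \<in> I" for i
    proof -
      have fi: "f i \<in> vecs (X i)" using f(1)[OF i] F(2)[OF i] by (auto simp: unit_sphere_def)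
      have bi: "0 < b i" using Wpos b i by blast
      have "y i - x i = b i *\<^sub>R ((z i - f i) + \<delta> *\<^sub>R z i)"
        using z(3)[OF i] i by (simp add: x_def c_def algebra_simps)
      also have "vnorm (X i) \<dots> = b i * vnorm (X i) ((z i - f i) + \<delta> *\<^sub>R z i)"
        using bi fi z(1)[OF i] ns_mem[OF ns[OF i]] by (subst ns_scale[OF ns[OF i]]) auto
      also have "vnorm (X i) ((z i - f i) + \<delta> *\<^sub>R z i) \<le> vnorm (X i) (z i - f i) + vnorm (X i) (\<delta> *\<^sub>R z i)"
        using fi z(1)[OF i] ns_mem[OF ns[OF i]] by (intro ns_triangle[OF ns[OF i]]) auto
      also have "vnorm (X i) (\<delta> *\<^sub>R z i) \<le> \<delta>"
        using z[OF i] assms(4) by (subst ns_scale[OF ns[OF i]]) (auto simp: mult_left_le)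
      also have "vnorm (X i) (z i - f i) \<le> e" using f i by blast
      finally have "vnorm (X i) (y i - x i) \<le> b i * (e + \<delta>)" using bi by simp
      moreover have "0 \<le> vnorm (X i) (y i - x i)"
        using i fi yi(1)[OF i] ns_mem[OF ns[OF i]]
        by (intro ns_nonneg[OF ns[OF i]]) (auto simp: x_def c_def)
      ultimately show ?thesis by (simp add: mult.commute)
    qed
    then have "vnorm (ell_sum p I X) (y - x) \<le> e + \<delta>"
      unfolding vnorm_ell_sum using assms(1-4) e Wpos[OF b(1)] Wnorm[OF b(1)]
      by (intro ell_norm_le_dominated[where b = b]) auto
    moreover have "x \<in> c ` (W \<times> PiE I F)"
      unfolding x_def using b(1) f(1) by (intro imageI) auto
    ultimately show "\<exists>x\<in>c ` (W \<times> PiE I F). vnorm (ell_sum p I X) (y - x) \<le> e + \<delta>" by blast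
  qed
qed

section \<open>Splitting off one coordinate, and centres supported on it\<close>

lemma summable_on_remove_iff:
  fixes f :: "'i \<Rightarrow> real"
  assumes "j \<in> I"
  shows "f summable_on I \<longleftrightarrow> f summable_on (I - {j})"
  using summable_on_insert_iff[of f j "I - {j}"] assms by (simp add: insert_absorb)

lemma infsum_remove:
  fixes f :: "'i \<Rightarrow> real"
  assumes "f summable_on I" "j \<in> I"
  shows "infsum f I = f j + infsum f (I - {j})"
  using infsum_insert[of f "I - {j}" j] assms summable_on_remove_iff[OF assms(2), of f]
  by (simp add: insert_absorb)

lemma infsum_concentrated:
  fixes f :: "'i \<Rightarrow> real"
  assumes "j \<in> I" "\<And>i. i \<in> I \<Longrightarrow> i \<noteq> j \<Longrightarrow> f i = 0"
  shows "f summable_on I" "infsum f I = f j"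
proof -
  have "f summable_on (I - {j}) \<longleftrightarrow> (\<lambda>_. 0 :: real) summable_on (I - {j})"
    using assms(2) by (intro summable_on_cong) simp
  then show s: "f summable_on I" using summable_on_remove_iff[OF assms(1)] by simp
  have "infsum f (I - {j}) = 0" using assms(2) by (intro infsum_0) simp
  then show "infsum f I = f j" using infsum_remove[OF s assms(1)] by simp
qed

text \<open>The isometric copy of \<open>X j\<close> in the sum supplies the centres for the upper
  estimates by the infimum and the test vector for the lower bound at finite exponents.\<close>

lemma single_mem_ell_sum:
  assumes "1 \<le> p" "j \<in> I" "v \<in> vecs (X j)"
    and ns: "\<And>i. i \<in> I \<Longrightarrow> normed_space (X i)"
  defines "x \<equiv> \<lambda>i. if i = j then v else 0"
  shows "x \<in> vecs (ell_sum p I X)" "vnorm (ell_sum p I X) x = vnorm (X j) v"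
proof -
  have nv: "0 \<le> vnorm (X j) v" using ns_nonneg[OF ns] assms(2,3) by blast
  have off: "vnorm (X i) (x i) = 0" if "i \<in> I" "i \<noteq> j" for i
    using that ns_zero[OF ns[OF that(1)]] by (simp add: x_def)
  have at: "vnorm (X j) (x j) = vnorm (X j) v" by (simp add: x_def)
  have mem: "\<forall>i\<in>I. x i \<in> vecs (X i)" "\<forall>i. i \<notin> I \<longrightarrow> x i = 0"
    using assms(2,3) ns_mem(1)[OF ns] by (auto simp: x_def)
  have "(\<lambda>i. vnorm (X i) (x i)) \<in> ell p I \<and> ell_norm p I (\<lambda>i. vnorm (X i) (x i)) = vnorm (X j) v"
  proof (cases "p = \<infinity>")
    case True
    have le: "\<bar>vnorm (X i) (x i)\<bar> \<le> vnorm (X j) v" if "i \<in> I" for i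
      using off[OF that] at nv by (cases "i = j") auto
    then have bdd: "bdd_above ((\<lambda>i. \<bar>vnorm (X i) (x i)\<bar>) ` I)" by (rule bdd_aboveI2)
    have "(SUP i\<in>I. \<bar>vnorm (X i) (x i)\<bar>) \<le> vnorm (X j) v"
      using le assms(2) by (intro cSUP_least) auto
    moreover have "\<bar>vnorm (X j) (x j)\<bar> \<le> (SUP i\<in>I. \<bar>vnorm (X i) (x i)\<bar>)"
      using bdd assms(2) by (intro cSUP_upper)
    ultimately show ?thesis using True bdd nv at by (simp add: ell_def ell_norm_infinity)
  next
    case False
    note q = one_le_real_of_ereal[OF assms(1) False]
    have "\<bar>vnorm (X i) (x i)\<bar> powr real_of_ereal p = 0" if "i \<in> I" "i \<noteq> j" for i
      using off[OF that] by simp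
    note conc = infsum_concentrated[OF assms(2) this]
    have "(vnorm (X j) v powr real_of_ereal p) powr (1 / real_of_ereal p) = vnorm (X j) v"
      using q nv by (simp add: powr_powr)
    then show ?thesis using conc False at nv by (simp add: ell_def ell_norm_finite_exponent)
  qed
  with mem show "x \<in> vecs (ell_sum p I X)" "vnorm (ell_sum p I X) x = vnorm (X j) v"
    by (auto simp: vecs_ell_sum vnorm_ell_sum)
qed

lemma ell_norm_coordinate_le:
  assumes "1 \<le> p" "a \<in> ell p I" "i \<in> I"
  shows "\<bar>a i\<bar> \<le> ell_norm p I a"
proof (cases "p = \<infinity>")
  case True
  then show ?thesis using assms by (auto simp: ell_def ell_norm_infinity intro: cSUP_upper)
next
  case False
  note q = one_le_real_of_ereal[OF assms(1) False]
  let ?f = "\<lambda>i. \<bar>a i\<bar> powr real_of_ereal p"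
  have s: "?f summable_on I" using assms(2) False by (simp add: ell_def)
  have "0 \<le> infsum ?f (I - {i})" by (intro infsum_nonneg) simp
  then have "?f i \<le> infsum ?f I" using infsum_remove[OF s assms(3)] by simp
  then have "?f i powr (1 / real_of_ereal p) \<le> infsum ?f I powr (1 / real_of_ereal p)"
    using q by (intro powr_mono2) auto
  then show ?thesis using q False by (simp add: ell_norm_finite_exponent powr_powr)
qed

text \<open>The centres are a net of \<open>X j\<close> placed in coordinate \<open>j\<close>.
  Subtracting a suitable one from \<open>y\<close> changes only the entry at \<open>j\<close>, whose
  norm becomes at most \<open>e\<close>. The assumption \<open>bound\<close> isolates the
  computation that differs between finite and infinite exponents.\<close>

lemma coverable_ell_sum_coordinate:
  fixes X :: "'i \<Rightarrow> 'a::real_vector nspace"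
  assumes "1 \<le> p" "j \<in> I" "coverable (X j) e" "0 < e'"
    and ns: "\<And>i. i \<in> I \<Longrightarrow> normed_space (X i)"
    and bound: "\<And>a c. \<lbrakk>a \<in> ell p I; ell_norm p I a \<le> 1; \<And>i. i \<in> I \<Longrightarrow> i \<noteq> j \<Longrightarrow> c i = a i;
      \<bar>c j\<bar> \<le> e\<rbrakk> \<Longrightarrow> ell_norm p I c \<le> e'"
  shows "coverable (ell_sum p I X) e'"
proof -
  obtain F where F: "finite F" "F \<subseteq> unit_sphere (X j)"
    "\<And>y. \<lbrakk>y \<in> vecs (X j); vnorm (X j) y \<le> 1\<rbrakk> \<Longrightarrow> \<exists>x\<in>F. vnorm (X j) (y - x) \<le> e"
    using assms(3) by (rule coverableE) blast
  define c where "c = (\<lambda>v :: 'a. \<lambda>i. if i = j then v else 0)"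
  show ?thesis
  proof (rule coverableI[of _ "c ` F"])
    show "c ` F \<subseteq> unit_sphere (ell_sum p I X)"
      using F(2) single_mem_ell_sum[where X = X, OF assms(1,2) _ ns] by (auto simp: unit_sphere_def c_def)
    fix y assume y: "y \<in> vecs (ell_sum p I X)" "vnorm (ell_sum p I X) y \<le> 1"
    have ell: "(\<lambda>i. vnorm (X i) (y i)) \<in> ell p I" and n1: "ell_norm p I (\<lambda>i. vnorm (X i) (y i)) \<le> 1"
      and yj: "y j \<in> vecs (X j)"
      using y assms(2) by (auto simp: vecs_ell_sum vnorm_ell_sum)
    have "vnorm (X j) (y j) \<le> 1"
      using ell_norm_coordinate_le[OF assms(1) ell assms(2)] n1 by linarith
    then obtain f where f: "f \<in> F" "vnorm (X j) (y j - f) \<le> e" using F(3) yj by blast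
    have "y j - f \<in> vecs (X j)"
      using f(1) F(2) yj ns_mem(4)[OF ns[OF assms(2)]] by (auto simp: unit_sphere_def)
    then have "0 \<le> vnorm (X j) (y j - f)" using ns_nonneg[OF ns[OF assms(2)]] by blast
    then have "vnorm (ell_sum p I X) (y - c f) \<le> e'"
      unfolding vnorm_ell_sum using f(2) by (intro bound[OF ell n1]) (auto simp: c_def)
    then show "\<exists>x\<in>c ` F. vnorm (ell_sum p I X) (y - x) \<le> e'" using f(1) by blast
  qed (use F(1) assms(4) in auto)
qed

text \<open>The entries away from \<open>j\<close> contribute at most 1 to the sum of
  \<open>p\<close>-th powers, and the entry at \<open>j\<close> at most the \<open>p\<close>-th
  power of \<open>e\<close>.\<close>

lemma coverable_ell_sum_finite_exponent:
  fixes X :: "'i \<Rightarrow> 'a::real_vector nspace"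
  assumes "1 \<le> p" "p \<noteq> \<infinity>" "j \<in> I" "coverable (X j) e"
    and ns: "\<And>i. i \<in> I \<Longrightarrow> normed_space (X i)"
  shows "coverable (ell_sum p I X) ((e powr real_of_ereal p + 1) powr (1 / real_of_ereal p))"
proof (rule coverable_ell_sum_coordinate[where j = j and e = e])
  note q = one_le_real_of_ereal[OF assms(1,2)]
  have ep: "0 < e powr real_of_ereal p + 1" by (intro add_nonneg_pos) simp_all
  then show "0 < (e powr real_of_ereal p + 1) powr (1 / real_of_ereal p)"
    unfolding powr_gt_zero by linarith
  fix a c :: "'i \<Rightarrow> real"
  assume a: "a \<in> ell p I" "ell_norm p I a \<le> 1"
    and c: "\<And>i. i \<in> I \<Longrightarrow> i \<noteq> j \<Longrightarrow> c i = a i" "\<bar>c j\<bar> \<le> e"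
  let ?f = "\<lambda>a i. \<bar>a i\<bar> powr real_of_ereal p"
  have sa: "?f a summable_on I" using a assms(2) by (simp add: ell_def)
  have "infsum (?f a) (I - {j}) \<le> infsum (?f a) I"
    using infsum_remove[OF sa assms(3)] by simp
  also have "\<dots> \<le> 1" using a(2) assms by (simp add: ell_norm_le_iff)
  finally have a1: "infsum (?f a) (I - {j}) \<le> 1" .
  have "?f c summable_on (I - {j}) \<longleftrightarrow> ?f a summable_on (I - {j})"
    using c(1) by (intro summable_on_cong) simp
  then have "?f c summable_on I"
    using sa summable_on_remove_iff[OF assms(3), of "?f c"] summable_on_remove_iff[OF assms(3), of "?f a"]
    by blast
  from infsum_remove[OF this assms(3)]
  have "infsum (?f c) I = ?f c j + infsum (?f c) (I - {j})" .
  also have "infsum (?f c) (I - {j}) = infsum (?f a) (I - {j})"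
    using c(1) by (intro infsum_cong) simp
  also have "?f c j + \<dots> \<le> e powr real_of_ereal p + 1"
    using a1 c(2) q by (intro add_mono powr_mono2) auto
  also have "\<dots> = ((e powr real_of_ereal p + 1) powr (1 / real_of_ereal p)) powr real_of_ereal p"
    using q ep by (simp add: powr_powr)
  finally show "ell_norm p I c \<le> (e powr real_of_ereal p + 1) powr (1 / real_of_ereal p)"
    using assms(1,2) by (simp add: ell_norm_le_iff)
qed (use assms in auto)

text \<open>The entries away from \<open>j\<close> are untouched and may have norm 1, so
  \<open>1 \<le> e\<close> is what keeps them within the radius.\<close>

lemma coverable_ell_sum_infinity:
  fixes X :: "'i \<Rightarrow> 'a::real_vector nspace"
  assumes "j \<in> I" "coverable (X j) e" "1 \<le> e"
    and ns: "\<And>i. i \<in> I \<Longrightarrow> normed_space (X i)"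
  shows "coverable (ell_sum \<infinity> I X) e"
proof (rule coverable_ell_sum_coordinate[where j = j and e = e])
  fix a c :: "'i \<Rightarrow> real"
  assume a: "a \<in> ell \<infinity> I" "ell_norm \<infinity> I a \<le> 1"
    and c: "\<And>i. i \<in> I \<Longrightarrow> i \<noteq> j \<Longrightarrow> c i = a i" "\<bar>c j\<bar> \<le> e"
  have "\<bar>c i\<bar> \<le> e" if "i \<in> I" for i
    using ell_norm_coordinate_le[OF _ a(1) that] a(2) c(1)[OF that] c(2) assms(3) by (cases "i = j") auto
  then show "ell_norm \<infinity> I c \<le> e"
    unfolding ell_norm_infinity using assms(1) by (intro cSUP_least) auto
qed (use assms in auto)

section \<open>Lower bounds\<close>

lemma coverable_ell_sum_infinityD:
  fixes X :: "'i \<Rightarrow> 'a::real_vector nspace"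
  assumes cov: "coverable (ell_sum \<infinity> I X) e" and "I \<noteq> {}" "0 < \<delta>"
    and ns: "\<And>i. i \<in> I \<Longrightarrow> normed_space (X i)"
  shows "\<exists>i\<in>I. coverable (X i) (e + \<delta>)"
proof (rule ccontr)
  assume neg: "\<not> ?thesis"
  have e: "0 < e" using coverable_pos[OF cov] .
  obtain F where F: "finite F" "F \<subseteq> unit_sphere (ell_sum \<infinity> I X)"
    "\<And>y. \<lbrakk>y \<in> vecs (ell_sum \<infinity> I X); vnorm (ell_sum \<infinity> I X) y \<le> 1\<rbrakk>
      \<Longrightarrow> \<exists>x\<in>F. vnorm (ell_sum \<infinity> I X) (y - x) \<le> e"
    using cov by (rule coverableE) blast
  have Fx: "x i \<in> vecs (X i)" "vnorm (X i) (x i) \<le> 1" if "x \<in> F" "i \<in> I" for x i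
  proof -
    have x: "x \<in> vecs (ell_sum \<infinity> I X)" "vnorm (ell_sum \<infinity> I X) x = 1"
      using F(2) that(1) by (auto simp: unit_sphere_def)
    then show "x i \<in> vecs (X i)" using that(2) by (simp add: vecs_ell_sum)
    have "\<bar>vnorm (X i) (x i)\<bar> \<le> ell_norm \<infinity> I (\<lambda>i. vnorm (X i) (x i))"
      using x(1) that(2) by (intro ell_norm_coordinate_le) (auto simp: vecs_ell_sum)
    then show "vnorm (X i) (x i) \<le> 1" using x(2) by (simp add: vnorm_ell_sum)
  qed
  \<comment> \<open>The cap 1/2 keeps the entries chosen below away from 0, so that they can be
    normalised.\<close>
  define \<eta> where "\<eta> = min \<delta> (1 / 2)"
  have \<eta>: "0 < \<eta>" "\<eta> \<le> \<delta>" "\<eta> < 1" using assms(3) by (auto simp: \<eta>_def)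
  have "\<exists>i\<in>I. 1 - \<eta> < vnorm (X i) (x i)" if x: "x \<in> F" for x
  proof (rule ccontr)
    assume no: "\<not> ?thesis"
    have "\<bar>vnorm (X i) (x i)\<bar> \<le> 1 - \<eta>" if "i \<in> I" for i
      using no that ns_nonneg[OF ns[OF that] Fx(1)[OF x that]] by (simp add: not_less)
    then have "vnorm (ell_sum \<infinity> I X) x \<le> 1 - \<eta>"
      unfolding vnorm_ell_sum ell_norm_infinity using assms(2) by (intro cSUP_least) auto
    then show False using x F(2) \<eta>(1) by (auto simp: unit_sphere_def)
  qed
  then obtain \<iota> where \<iota>: "\<And>x. x \<in> F \<Longrightarrow> \<iota> x \<in> I" "\<And>x. x \<in> F \<Longrightarrow> 1 - \<eta> < vnorm (X (\<iota> x)) (x (\<iota> x))"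
    by metis
  define g where "g = (\<lambda>x :: 'i \<Rightarrow> 'a. (1 / vnorm (X (\<iota> x)) (x (\<iota> x))) *\<^sub>R x (\<iota> x))"
  have g: "g x \<in> unit_sphere (X (\<iota> x))" if "x \<in> F" for x
    unfolding g_def using \<iota>[OF that] \<eta> Fx(1)[OF that]
    by (intro ns_normalize[OF ns]) auto
  have "\<exists>v\<in>vecs (X i). vnorm (X i) v \<le> 1 \<and> (\<forall>x\<in>F. \<iota> x = i \<longrightarrow> e + \<delta> < vnorm (X i) (v - g x))"
    if i: "i \<in> I" for i
  proof (rule ccontr)
    assume no: "\<not> ?thesis"
    have "coverable (X i) (e + \<delta>)"
    proof (rule coverableI[of _ "g ` {x \<in> F. \<iota> x = i}"])
      show "\<exists>x\<in>g ` {x \<in> F. \<iota> x = i}. vnorm (X i) (v - x) \<le> e + \<delta>"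
        if "v \<in> vecs (X i)" "vnorm (X i) v \<le> 1" for v
        using no that by (force simp: not_less)
    qed (use F(1) g e assms(3) in auto)
    with neg i show False by blast
  qed
  then obtain v where v: "\<And>i. i \<in> I \<Longrightarrow> v i \<in> vecs (X i)" "\<And>i. i \<in> I \<Longrightarrow> vnorm (X i) (v i) \<le> 1"
    "\<And>i x. \<lbrakk>i \<in> I; x \<in> F; \<iota> x = i\<rbrakk> \<Longrightarrow> e + \<delta> < vnorm (X i) (v i - g x)"
    by metis
  define y where "y = (\<lambda>i. if i \<in> I then v i else 0)"
  have yi: "y i \<in> vecs (X i)" "\<bar>vnorm (X i) (y i)\<bar> \<le> 1" if "i \<in> I" for i
    using v(1,2)[OF that] ns_nonneg[OF ns[OF that] v(1)[OF that]] that by (auto simp: y_def)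
  have "bdd_above ((\<lambda>i. \<bar>vnorm (X i) (y i)\<bar>) ` I)" using yi(2) by (rule bdd_aboveI2)
  then have y: "y \<in> vecs (ell_sum \<infinity> I X)"
    using yi(1) by (simp add: vecs_ell_sum ell_def y_def)
  have "vnorm (ell_sum \<infinity> I X) y \<le> 1"
    unfolding vnorm_ell_sum ell_norm_infinity using assms(2) yi(2) by (intro cSUP_least) auto
  with y F(3) obtain x where x: "x \<in> F" "vnorm (ell_sum \<infinity> I X) (y - x) \<le> e" by blast
  define i where "i = \<iota> x"
  have i: "i \<in> I" using \<iota>(1)[OF x(1)] by (simp add: i_def)
  note nsi = ns[OF i]
  \<comment> \<open>This bound puts the norms of \<open>y - x\<close> into
    \<open>ell \<infinity> I\<close>; only then does the supremum dominate each coordinate.\<close>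
  have "\<bar>vnorm (X k) ((y - x) k)\<bar> \<le> 2" if k: "k \<in> I" for k
  proof -
    have "vnorm (X k) (y k - x k) \<le> vnorm (X k) (y k) + vnorm (X k) (x k)"
      using ns_triangle_diff[OF ns[OF k]] yi(1)[OF k] Fx(1)[OF x(1) k] by blast
    moreover have "0 \<le> vnorm (X k) (y k - x k)"
      using ns_nonneg[OF ns[OF k]] ns_mem(4)[OF ns[OF k]] yi(1)[OF k] Fx(1)[OF x(1) k] by blast
    ultimately show ?thesis using yi(2)[OF k] Fx(2)[OF x(1) k] by simp
  qed
  then have "bdd_above ((\<lambda>i. \<bar>vnorm (X i) ((y - x) i)\<bar>) ` I)" by (rule bdd_aboveI2)
  then have "(\<lambda>i. vnorm (X i) ((y - x) i)) \<in> ell \<infinity> I" by (simp add: ell_def)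
  from ell_norm_coordinate_le[OF _ this i] x(2)
  have le: "vnorm (X i) (y i - x i) \<le> e" by (simp add: vnorm_ell_sum)
  define r where "r = vnorm (X i) (x i)"
  have r: "1 - \<eta> < r" "r \<le> 1" using \<iota>(2)[OF x(1)] Fx(2)[OF x(1) i] by (simp_all add: r_def i_def)
  have xi: "x i \<in> vecs (X i)" using Fx(1)[OF x(1) i] .
  have gx: "g x \<in> vecs (X i)" using g[OF x(1)] by (simp add: unit_sphere_def i_def)
  \<comment> \<open>Normalising moves \<open>x i\<close> along its own ray by exactly
    \<open>1 - r\<close>, which is below \<open>\<eta>\<close> and hence below
    \<open>\<delta>\<close>.\<close>
  have "x i - g x = (1 - 1 / r) *\<^sub>R x i" by (simp add: g_def r_def i_def scaleR_left_diff_distrib)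
  then have "vnorm (X i) (x i - g x) = \<bar>1 - 1 / r\<bar> * r" using ns_scale[OF nsi xi] by (simp add: r_def)
  also have "\<dots> = 1 - r"
  proof -
    have "\<bar>1 - 1 / r\<bar> = 1 / r - 1" using r \<eta>(3) by (simp add: field_simps)
    then show ?thesis using r \<eta>(3) by (simp add: field_simps)
  qed
  finally have "vnorm (X i) (x i - g x) < \<delta>" using r \<eta>(2) by simp
  moreover have "vnorm (X i) (y i - g x) \<le> vnorm (X i) (y i - x i) + vnorm (X i) (x i - g x)"
    using yi(1)[OF i] xi gx by (intro ns_triangle3[OF nsi])
  moreover have "e + \<delta> < vnorm (X i) (y i - g x)"
    using v(3)[OF i x(1)] i by (simp add: i_def[symmetric] y_def)
  ultimately show False using le by linarith
qed

text \<open>Take a coordinate \<open>n\<close> where all centres have norm below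
  \<open>\<eta>\<close>, and a unit vector of \<open>X n\<close> there. In the \<open>q\<close>-th
  power of its distance to a centre, the entry at \<open>n\<close> contributes at least
  \<open>(1 - \<eta>) powr q\<close> and the other entries at least
  \<open>1 - \<eta> powr q\<close>. Letting \<open>\<eta>\<close> tend to 0 gives
  \<open>2 \<le> e powr q\<close>.\<close>

lemma two_powr_le_if_coverable:
  fixes X :: "nat \<Rightarrow> 'a::real_vector nspace"
  assumes "1 \<le> p" "p \<noteq> \<infinity>" "coverable (ell_sum p UNIV X) e"
    and ns: "\<And>i. normed_space (X i)" and inf: "\<And>i. infinite_dimensional (X i)"
  shows "2 powr (1 / real_of_ereal p) \<le> e"
proof -
  define q where "q = real_of_ereal p"
  have q: "1 \<le> q" using one_le_real_of_ereal[OF assms(1,2)] by (simp add: q_def)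
  have e: "0 < e" using coverable_pos[OF assms(3)] .
  obtain F where F: "finite F" "F \<subseteq> unit_sphere (ell_sum p UNIV X)"
    "\<And>y. \<lbrakk>y \<in> vecs (ell_sum p UNIV X); vnorm (ell_sum p UNIV X) y \<le> 1\<rbrakk>
      \<Longrightarrow> \<exists>x\<in>F. vnorm (ell_sum p UNIV X) (y - x) \<le> e"
    using assms(3) by (rule coverableE) blast
  define f where "f = (\<lambda>x i. \<bar>vnorm (X i) (x i)\<bar> powr q)"
  have Fx: "f x summable_on UNIV" "infsum (f x) UNIV = 1" "\<And>i. x i \<in> vecs (X i)" if "x \<in> F" for x
    using F(2) that assms(1,2)
    by (auto simp: unit_sphere_def vecs_ell_sum vnorm_ell_sum ell_def ell_norm_eq_1_iff f_def q_def)
  have key: "(1 - \<eta>) powr q + (1 - \<eta> powr q) \<le> e powr q" if \<eta>: "0 < \<eta>" "\<eta> < 1" for \<eta>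
  proof -
    have "\<forall>\<^sub>F n in sequentially. f x n < \<eta> powr q" if "x \<in> F" for x
      using summable_LIMSEQ_zero[OF summable_on_imp_summable[OF Fx(1)[OF that]]] \<eta>
      by (intro order_tendstoD(2)) auto
    then have "\<forall>\<^sub>F n in sequentially. \<forall>x\<in>F. f x n < \<eta> powr q"
      using F(1) by (simp add: eventually_ball_finite)
    \<comment> \<open>The terms of each of the finitely many convergent series tend to 0, so one
      index serves for all centres.\<close>
    then have "\<exists>n. \<forall>x\<in>F. f x n < \<eta> powr q" by (rule eventually_happens'[OF sequentially_bot])
    then obtain n where n: "\<And>x. x \<in> F \<Longrightarrow> f x n < \<eta> powr q" by blast
    obtain u where u: "u \<in> vecs (X n)" "vnorm (X n) u = 1"
      using infinite_dimensional_unit_vector[OF ns inf] by (auto simp: unit_sphere_def)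
    define y where "y = (\<lambda>i. if i = n then u else 0)"
    have "y \<in> vecs (ell_sum p UNIV X)" "vnorm (ell_sum p UNIV X) y = 1"
      using single_mem_ell_sum[where X = X and I = UNIV, OF assms(1) UNIV_I u(1) ns] u(2) by (simp_all add: y_def)
    then obtain x where x: "x \<in> F" "vnorm (ell_sum p UNIV X) (y - x) \<le> e" using F(3) by fastforce
    have off: "f (y - x) i = f x i" if "i \<noteq> n" for i
      using that ns_minus[OF ns Fx(3)[OF x(1)]] by (simp add: f_def y_def)
    have "f (y - x) summable_on (UNIV - {n}) \<longleftrightarrow> f x summable_on (UNIV - {n})"
      using off by (intro summable_on_cong) simp
    then have "f (y - x) summable_on UNIV"
      using Fx(1)[OF x(1)] summable_on_remove_iff[OF UNIV_I[of n], of "f (y - x)"]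
        summable_on_remove_iff[OF UNIV_I[of n], of "f x"] by blast
    then have "infsum (f (y - x)) UNIV = f (y - x) n + infsum (f (y - x)) (UNIV - {n})"
      by (rule infsum_remove) simp
    also have "infsum (f (y - x)) (UNIV - {n}) = infsum (f x) (UNIV - {n})"
      using off by (intro infsum_cong) simp
    also have "\<dots> = 1 - f x n" using infsum_remove[OF Fx(1)[OF x(1)] UNIV_I[of n]] Fx(2)[OF x(1)] by simp
    finally have sum: "infsum (f (y - x)) UNIV = f (y - x) n + (1 - f x n)" .
    have "vnorm (X n) (x n) < \<eta>"
    proof (rule ccontr)
      assume "\<not> ?thesis"
      then have "\<eta> powr q \<le> \<bar>vnorm (X n) (x n)\<bar> powr q" using \<eta> q by (intro powr_mono2) auto
      with n[OF x(1)] show False by (simp add: f_def)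
    qed
    then have "1 - \<eta> \<le> vnorm (X n) (u - x n)"
      using ns_triangle_sub[OF ns u(1) Fx(3)[OF x(1)]] u(2) by (simp add: algebra_simps)
    then have "(1 - \<eta>) powr q \<le> f (y - x) n"
      unfolding f_def using \<eta> q by (intro powr_mono2) (auto simp: y_def)
    with n[OF x(1)] have "(1 - \<eta>) powr q + (1 - \<eta> powr q) \<le> infsum (f (y - x)) UNIV"
      unfolding sum by linarith
    also have "\<dots> \<le> e powr q"
      using x(2) assms(1,2) e by (simp add: vnorm_ell_sum ell_norm_le_iff f_def q_def)
    finally show ?thesis .
  qed
  \<comment> \<open>At the base 0 the function \<open>powr\<close> is continuous from the right
    because the exponent \<open>q\<close> is positive; there \<open>0 powr q = 0\<close>.\<close>
  have "((\<lambda>\<eta>::real. (1 - \<eta>) powr q + (1 - \<eta> powr q)) \<longlongrightarrow> (1 - 0) powr q + (1 - 0 powr q)) (at_right 0)"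
    using q by (intro tendsto_intros tendsto_powr') (auto simp: eventually_at_right_less intro: eventually_mono[OF eventually_at_right_less])
  moreover have "\<forall>\<^sub>F \<eta> in at_right (0::real). (1 - \<eta>) powr q + (1 - \<eta> powr q) \<le> e powr q"
    using key by (auto simp: eventually_at_right_field intro!: exI[of _ 1])
  ultimately have "(1 - 0) powr q + (1 - 0 powr q) \<le> e powr q"
    by (intro tendsto_upperbound) auto
  then have "2 \<le> e powr q" by simp
  then have "2 powr (1 / q) \<le> (e powr q) powr (1 / q)" using q by (intro powr_mono2) auto
  then show ?thesis using q e by (simp add: powr_powr q_def)
qed

section \<open>From covering radii to thickness\<close>

text \<open>An infimum \<open>c\<close> need not be an admissible radius itself, so only radii above
  \<open>c\<close> are available; letting them decrease to \<open>c\<close> closes the gap.\<close>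

lemma thickness_le_tendsto:
  fixes c :: real and g :: "real \<Rightarrow> real"
  assumes "\<And>e. c < e \<Longrightarrow> coverable Y (g e)" "(g \<longlongrightarrow> g c) (at_right c)"
  shows "thickness Y \<le> g c"
proof (rule tendsto_lowerbound[OF assms(2)])
  show "\<forall>\<^sub>F e in at_right c. thickness Y \<le> g e"
    by (rule eventually_mono[OF eventually_at_right_less]) (intro thickness_le assms(1))
qed simp

text \<open>The index \<open>j\<close> may depend on \<open>e\<close>, so one statement serves both
  the minimum over a finite family and an infimum that is not attained.\<close>

lemma thickness_ell_sum_le:
  assumes "1 \<le> p" "p \<noteq> \<infinity>" "0 \<le> c"
    and ns: "\<And>i. i \<in> I \<Longrightarrow> normed_space (X i)"
    and cov: "\<And>e. c < e \<Longrightarrow> \<exists>j\<in>I. coverable (X j) e"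
  shows "thickness (ell_sum p I X) \<le> (c powr real_of_ereal p + 1) powr (1 / real_of_ereal p)"
proof (rule thickness_le_tendsto[where c = c and
      g = "\<lambda>e. (e powr real_of_ereal p + 1) powr (1 / real_of_ereal p)"])
  show "coverable (ell_sum p I X) ((e powr real_of_ereal p + 1) powr (1 / real_of_ereal p))"
    if e: "c < e" for e
  proof -
    obtain j where "j \<in> I" "coverable (X j) e" using cov[OF e] by blast
    then show ?thesis using assms(1,2) ns by (intro coverable_ell_sum_finite_exponent)
  qed
  have "\<forall>\<^sub>F e in at_right c. 0 \<le> e"
    using assms(3) by (auto intro: eventually_mono[OF eventually_at_right_less])
  then show "((\<lambda>e. (e powr real_of_ereal p + 1) powr (1 / real_of_ereal p)) \<longlongrightarrow>
      (c powr real_of_ereal p + 1) powr (1 / real_of_ereal p)) (at_right c)"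
    using one_le_real_of_ereal[OF assms(1,2)]
    by (intro tendsto_intros tendsto_powr') (auto simp: add_nonneg_eq_0_iff)
qed

theorem theorem2:
  fixes p :: ereal
  assumes "1 \<le> p"
  shows
    "(\<forall>N\<ge>1. \<forall>X :: nat \<Rightarrow> 'a::real_vector nspace.
        (\<forall>n\<in>{1..N}. banach_space (X n) \<and> infinite_dimensional (X n)) \<longrightarrow>
        thickness (ell_sum p {1..N} X) \<le> Max ((\<lambda>n. thickness (X n)) ` {1..N}))
     \<and>
     (p < \<infinity> \<longrightarrow>
        (\<forall>X :: nat \<Rightarrow> 'a nspace.
           (\<forall>n. banach_space (X n) \<and> infinite_dimensional (X n)) \<longrightarrow>
           2 powr (1 / real_of_ereal p) \<le> thickness (ell_sum p UNIV X) \<and>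
           thickness (ell_sum p UNIV X)
             \<le> ((INF n. thickness (X n)) powr real_of_ereal p + 1) powr (1 / real_of_ereal p)) \<and>
        (\<forall>N\<ge>1. \<forall>X :: nat \<Rightarrow> 'a nspace.
           (\<forall>n\<in>{1..N}. banach_space (X n) \<and> infinite_dimensional (X n)) \<longrightarrow>
           thickness (ell_sum p {1..N} X)
             \<le> ((Min ((\<lambda>n. thickness (X n)) ` {1..N})) powr real_of_ereal p + 1)
                 powr (1 / real_of_ereal p)))
     \<and>
     (\<forall>X :: nat \<Rightarrow> 'a nspace.
        (\<forall>n. banach_space (X n) \<and> infinite_dimensional (X n)) \<longrightarrow>
        thickness (ell_sum \<infinity> UNIV X) = (INF n. thickness (X n)))"
proof (intro conjI allI impI)
  fix N :: nat and X :: "nat \<Rightarrow> 'a nspace"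
  assume N: "1 \<le> N" and X: "\<forall>n\<in>{1..N}. banach_space (X n) \<and> infinite_dimensional (X n)"
  have ns: "normed_space (X n)" "infinite_dimensional (X n)" if "n \<in> {1..N}" for n
    using X that by (auto simp: banach_space_def)
  define M where "M = Max ((\<lambda>n. thickness (X n)) ` {1..N})"
  show "thickness (ell_sum p {1..N} X) \<le> Max ((\<lambda>n. thickness (X n)) ` {1..N})"
    unfolding M_def[symmetric]
  proof (rule field_le_epsilon)
    fix \<epsilon> :: real assume \<epsilon>: "0 < \<epsilon>"
    \<comment> \<open>One half of \<open>\<epsilon>\<close> lifts the radius above every thickness,
      the other is the loss in passing to the sum.\<close>
    have "coverable (X n) (M + \<epsilon> / 2)" if n: "n \<in> {1..N}" for n
    proof -
      have "thickness (X n) \<le> M" unfolding M_def using n by (intro Max_ge) auto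
      then show ?thesis using \<epsilon> by (intro coverable_if_thickness_less[OF ns[OF n]]) simp
    qed
    then have "coverable (ell_sum p {1..N} X) (M + \<epsilon> / 2 + \<epsilon> / 2)"
      using assms N \<epsilon> ns(1) by (intro coverable_ell_sum_finite) auto
    then show "thickness (ell_sum p {1..N} X) \<le> M + \<epsilon>" using thickness_le by fastforce
  qed
next
  fix N :: nat and X :: "nat \<Rightarrow> 'a nspace"
  assume p: "p < \<infinity>" and N: "1 \<le> N"
    and X: "\<forall>n\<in>{1..N}. banach_space (X n) \<and> infinite_dimensional (X n)"
  have ns: "normed_space (X n)" "infinite_dimensional (X n)" if "n \<in> {1..N}" for n
    using X that by (auto simp: banach_space_def)
  define m where "m = Min ((\<lambda>n. thickness (X n)) ` {1..N})"
  have "m \<in> (\<lambda>n. thickness (X n)) ` {1..N}" unfolding m_def using N by (intro Min_in) auto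
  then obtain n where n: "n \<in> {1..N}" "m = thickness (X n)" by blast
  have "0 \<le> m" using one_le_thickness[OF ns[OF n(1)]] n(2) by simp
  moreover have "\<exists>j\<in>{1..N}. coverable (X j) e" if "m < e" for e
    using coverable_if_thickness_less[OF ns[OF n(1)]] n that by blast
  ultimately show "thickness (ell_sum p {1..N} X)
      \<le> ((Min ((\<lambda>n. thickness (X n)) ` {1..N})) powr real_of_ereal p + 1) powr (1 / real_of_ereal p)"
    unfolding m_def[symmetric] using assms p ns(1) by (intro thickness_ell_sum_le) auto
next
  fix X :: "nat \<Rightarrow> 'a nspace"
  assume "\<forall>n. banach_space (X n) \<and> infinite_dimensional (X n)"
  then have ns: "normed_space (X n)" "infinite_dimensional (X n)" for n
    by (auto simp: banach_space_def)
  have bdd: "bdd_below (range (\<lambda>n. thickness (X n)))"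
    using one_le_thickness[OF ns] by (rule bdd_belowI2)
  define m where "m = (INF n. thickness (X n))"
  have m: "1 \<le> m" unfolding m_def using one_le_thickness[OF ns] by (intro cINF_greatest) auto
  have cov: "\<exists>j. coverable (X j) e" if e: "m < e" for e
  proof -
    obtain n where "thickness (X n) < e"
      using e cINF_less_iff[OF UNIV_not_empty bdd] unfolding m_def by blast
    then show ?thesis using coverable_if_thickness_less[OF ns] by blast
  qed
  \<comment> \<open>The two estimates for finite \<open>p\<close> carry the extra assumption
    \<open>p < \<infinity>\<close>; the facts about \<open>X\<close> are shared with the claim on
    the supremum norm.\<close>
  {
    assume "p < \<infinity>"
    then have p: "p \<noteq> \<infinity>" by simp
    show "thickness (ell_sum p UNIV X)
        \<le> ((INF n. thickness (X n)) powr real_of_ereal p + 1) powr (1 / real_of_ereal p)"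
      unfolding m_def[symmetric] using assms p ns(1) m cov by (intro thickness_ell_sum_le) auto
    \<comment> \<open>Any radius above the infimum will do here; it only supplies the admissible
      radius that \<open>le_thickness\<close> asks for.\<close>
    obtain j where "coverable (X j) (m + 1)" using cov[of "m + 1"] by auto
    from coverable_ell_sum_finite_exponent[where X = X and I = UNIV, OF assms p UNIV_I this ns(1)]
    show "2 powr (1 / real_of_ereal p) \<le> thickness (ell_sum p UNIV X)"
      using two_powr_le_if_coverable[OF assms p _ ns] by (rule le_thickness)
  }
  have sum_cov: "coverable (ell_sum \<infinity> UNIV X) e" if e: "m < e" for e
  proof -
    obtain j where "coverable (X j) e" using cov[OF e] by blast
    then show ?thesis using e m ns(1) by (intro coverable_ell_sum_infinity[of j]) auto
  qed
  have "thickness (ell_sum \<infinity> UNIV X) \<le> m"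
    using thickness_le_tendsto[where g = "\<lambda>e. e", OF sum_cov] by simp
  moreover have "m \<le> thickness (ell_sum \<infinity> UNIV X)"
  proof (rule le_thickness)
    show "coverable (ell_sum \<infinity> UNIV X) (m + 1)" by (rule sum_cov) simp
    fix e assume e: "coverable (ell_sum \<infinity> UNIV X) e"
    show "m \<le> e"
    \<comment> \<open>Passing from the sum to one of its coordinates enlarges the radius by an
      arbitrarily small \<open>\<delta>\<close>.\<close>
    proof (rule field_le_epsilon)
      fix \<delta> :: real assume "0 < \<delta>"
      then obtain i where i: "coverable (X i) (e + \<delta>)"
        using coverable_ell_sum_infinityD[OF e _ _ ns(1)] by auto
      have "m \<le> thickness (X i)" unfolding m_def using bdd by (intro cINF_lower) auto
      also have "\<dots> \<le> e + \<delta>" using thickness_le[OF i] .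
      finally show "m \<le> e + \<delta>" .
    qed
  qed
  ultimately show "thickness (ell_sum \<infinity> UNIV X) = (INF n. thickness (X n))"
    unfolding m_def[symmetric] by simp
qed

end
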